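(* Let $J=\begin{pmatrix}0&I\\-I&0\end{pmatrix}$, let $Q$ be a real symmetric matrix, let $U$ be a smooth real-valued function, and put $M=-J^{-1}Q$ and $f(y)=J^{-1}\nabla U(y)$. Consider the Hamiltonian system $y'(t)+My(t)=f(y(t))$ and, for a stepsize $h>0$, an $s$-stage MVERK method with $\bar w_s(z)=0$ and real coefficients $\bar a_{ij},\bar b_i$ ($i,j=1,\ldots,s$): $$\bar Y_i=\bar y_n+h\sum_{j=1}^s\bar a_{ij}\big(-M\bar Y_j+f(\bar Y_j)\big),\quad i=1,\ldots,s,\qquad \bar y_{n+1}=e^{-hM}\bar y_n+h\sum_{i=1}^s\bar b_if(\bar Y_i).$$ Let $D_i=\frac{\partial f}{\partial y}(\bar Y_i)$ be the Jacobian matrix of $f$ at $\bar Y_i$. Suppose that $$D_i^{\intercal}Je^{-hM}+(e^{-hM})^{\intercal}JD_i=0,\qquad i=1,\ldots,s,$$ $$\bar b_i\bar b_j\,I=\bar b_i\bar a_{ij}\,Je^{-hM}J^{-1}+\bar b_j\bar a_{ji}\,(e^{-hM})^{\intercal},\qquad i,j=1,\ldots,s,$$ $$\bar b_j\bar a_{ji}M^{\intercal}(e^{-hM})^{\intercal}JD_j+\bar b_i\bar a_{ij}D_i^{\intercal}Je^{-hM}M=0,\qquad i,j=1,\ldots,s.$$ Then the MVERK method is symplectic.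
   Context: A modified-version exponential Runge--Kutta (MVERK) method with $s$ stages for $y'(t)+My(t)=f(y(t))$, $y(t_0)=y_0$, is $$\bar Y_i=y_0+h\sum_{j=1}^s\bar a_{ij}(-M\bar Y_j+f(\bar Y_j))\ (i=1,\ldots,s),\qquad \bar y_1=e^{-hM}y_0+h\sum_{i=1}^s\bar b_if(\bar Y_i)+\bar w_s(z),$$ with real constants $\bar a_{ij},\bar b_i$ and a correction term $\bar w_s(z)$ (here taken to be $0$). A numerical method is symplectic if $$\Big(\frac{\partial \bar y_{n+1}}{\partial y_0}\Big)^{\intercal}J\Big(\frac{\partial \bar y_{n+1}}{\partial y_0}\Big)=\Big(\frac{\partial \bar y_n}{\partial y_0}\Big)^{\intercal}J\Big(\frac{\partial \bar y_n}{\partial y_0}\Big).$$ It is understood that the stages $\bar Y_i$ are (locally) defined and differentiable as functions of $\bar y_n$, so that these derivatives exist, and that the hypotheses hold at the values $\bar y_n$ under consideration. $I$ is the identity matrix of the appropriate size. *)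

theory Defs
  imports "HOL-Analysis.Analysis"
begin

text \<open>
  The phase space of dimension \<open>2d\<close> is \<open>real ^ ('d + 'd)\<close>: the index type \<open>'d + 'd\<close>
  carries the two-by-two block structure, \<open>Inl\<close> indexing the first and \<open>Inr\<close> the second block.
\<close>

definition symp_J :: "real ^ ('d::finite + 'd) ^ ('d + 'd)" where
  "symp_J = (\<chi> i j. case (i, j) of
       (Inl a, Inr b) \<Rightarrow> if a = b then 1 else 0
     | (Inr a, Inl b) \<Rightarrow> if a = b then - 1 else 0
     | _ \<Rightarrow> 0)"

text \<open>
  The library multiplication \<open>*\<close> and powers on \<open>real ^ 'n ^ 'n\<close> are componentwise, so the
  matrix exponential is defined by its power series with respect to \<open>**\<close>.
\<close>

primrec mat_power :: "real ^ 'n ^ 'n \<Rightarrow> nat \<Rightarrow> real ^ 'n ^ 'n" where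
  "mat_power A 0 = mat 1"
| "mat_power A (Suc k) = A ** mat_power A k"

definition mat_exp :: "real ^ 'n ^ 'n \<Rightarrow> real ^ 'n ^ 'n" where
  "mat_exp A = (\<Sum>k. (1 / fact k) *\<^sub>R mat_power A k)"

primrec C_diff :: "nat \<Rightarrow> ('a::euclidean_space \<Rightarrow> real) \<Rightarrow> bool" where
  "C_diff 0 g \<longleftrightarrow> continuous_on UNIV g"
| "C_diff (Suc k) g \<longleftrightarrow> (\<forall>x. g differentiable (at x)) \<and>
     (\<forall>b\<in>Basis. C_diff k (\<lambda>x. frechet_derivative g (at x) b))"

definition smooth_fun :: "('a::euclidean_space \<Rightarrow> real) \<Rightarrow> bool" where
  "smooth_fun g \<longleftrightarrow> (\<forall>k. C_diff k g)"

definition gradient :: "('a::real_inner \<Rightarrow> real) \<Rightarrow> 'a \<Rightarrow> 'a" where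
  "gradient g x = (THE D. GDERIV g x :> D)"

lemma gradient_works:
  fixes g :: "'a::euclidean_space \<Rightarrow> real"
  assumes "g differentiable (at x)"
  shows "GDERIV g x :> gradient g x"
proof -
  let ?D = "\<Sum>b\<in>Basis. frechet_derivative g (at x) b *\<^sub>R b"
  have d: "(g has_derivative frechet_derivative g (at x)) (at x)"
    using assms frechet_derivative_works by blast
  have l: "linear (frechet_derivative g (at x))"
    using d has_derivative_linear by blast
  have "frechet_derivative g (at x) = (\<lambda>h. inner h ?D)"
  proof
    fix h :: 'a
    have "frechet_derivative g (at x) h
        = frechet_derivative g (at x) (\<Sum>b\<in>Basis. inner h b *\<^sub>R b)"
      by (simp add: euclidean_representation)
    also have "\<dots> = (\<Sum>b\<in>Basis. inner h b * frechet_derivative g (at x) b)"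
      by (simp add: linear_sum[OF l] linear_cmul[OF l])
    also have "\<dots> = inner h ?D"
      by (simp add: inner_sum_right mult.commute)
    finally show "frechet_derivative g (at x) h = inner h ?D" .
  qed
  then have ex: "GDERIV g x :> ?D"
    using d by (simp add: gderiv_def)
  have uniq: "D = ?D" if "GDERIV g x :> D" for D
  proof -
    have "(\<lambda>h. inner h D) = (\<lambda>h. inner h ?D)"
      using that ex has_derivative_unique unfolding gderiv_def by blast
    then show ?thesis
      by (metis vector_eq_ldot)
  qed
  show ?thesis
    unfolding gradient_def by (rule theI[of "\<lambda>D. GDERIV g x :> D", OF ex uniq])
qed

text \<open>
  \<open>Y i y\<close> is the stage \<open>Y\<^sub>i\<close> of the step that starts at \<open>y\<close>. The method is implicit and its stage
  equations need not have a global or unique solution, so \<open>Y\<close> is any solution branch that is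
  defined near \<open>x\<close> and differentiable at \<open>x\<close>.
\<close>

definition mverk_stages_at ::
  "real \<Rightarrow> real ^ 'n ^ 'n \<Rightarrow> (real ^ 'n \<Rightarrow> real ^ 'n) \<Rightarrow> nat \<Rightarrow> (nat \<Rightarrow> nat \<Rightarrow> real) \<Rightarrow>
   (nat \<Rightarrow> real ^ 'n \<Rightarrow> real ^ 'n) \<Rightarrow> real ^ 'n \<Rightarrow> bool" where
  "mverk_stages_at h M f s a Y x \<longleftrightarrow>
     (\<forall>\<^sub>F y in nhds x. \<forall>i\<in>{1..s}.
        Y i y = y + h *\<^sub>R (\<Sum>j=1..s. a i j *\<^sub>R (- (M *v Y j y) + f (Y j y)))) \<and>
     (\<forall>i\<in>{1..s}. Y i differentiable (at x))"

text \<open>The update with vanishing correction term.\<close>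

definition mverk_step ::
  "real \<Rightarrow> real ^ 'n ^ 'n \<Rightarrow> (real ^ 'n \<Rightarrow> real ^ 'n) \<Rightarrow> nat \<Rightarrow> (nat \<Rightarrow> real) \<Rightarrow>
   (nat \<Rightarrow> real ^ 'n \<Rightarrow> real ^ 'n) \<Rightarrow> real ^ 'n \<Rightarrow> real ^ 'n" where
  "mverk_step h M f s b Y y =
     mat_exp (- (h *\<^sub>R M)) *v y + h *\<^sub>R (\<Sum>i=1..s. b i *\<^sub>R f (Y i y))"

text \<open>
  For a one-step map \<open>\<Phi>\<close>, the numerical solution as a function of the initial value is
  \<open>y\<^sub>n = \<Phi> ^^ n\<close>. The set \<open>S\<close> consists of the values \<open>y\<^sub>n\<close> under consideration; differentiability
  is included because \<open>jacobian\<close> is only meaningful for differentiable functions.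
\<close>

definition symplectic_method_on ::
  "(real ^ ('d + 'd)) set \<Rightarrow> (real ^ ('d + 'd) \<Rightarrow> real ^ ('d::finite + 'd)) \<Rightarrow> bool" where
  "symplectic_method_on S \<Phi> \<longleftrightarrow>
     (\<forall>n y0. (\<forall>k\<le>n. (\<Phi> ^^ k) y0 \<in> S) \<longrightarrow>
        (\<Phi> ^^ n) differentiable (at y0) \<and>
        (\<Phi> ^^ Suc n) differentiable (at y0) \<and>
        transpose (jacobian (\<Phi> ^^ Suc n) (at y0)) ** symp_J ** jacobian (\<Phi> ^^ Suc n) (at y0)
          = transpose (jacobian (\<Phi> ^^ n) (at y0)) ** symp_J ** jacobian (\<Phi> ^^ n) (at y0))"

end

theory Submission
  imports Defs
begin

text \<open>
  With \<open>\<omega> u v = u\<^sup>T J v\<close>, the matrix \<open>J M\<close> is symmetric, so \<open>t \<mapsto> \<omega> (e\<^sup>-\<^sup>t\<^sup>M u) (e\<^sup>-\<^sup>t\<^sup>M v)\<close> has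
  derivative zero and \<open>E = e\<^sup>-\<^sup>h\<^sup>M\<close> preserves \<open>\<omega>\<close>. The derivative of the step in direction \<open>v\<close> is
  \<open>E v + h \<Sum> b\<^sub>i x\<^sub>i\<close> with \<open>x\<^sub>i = D\<^sub>i p\<^sub>i\<close>, where \<open>p\<^sub>i\<close> is the derivative of the stage \<open>Y\<^sub>i\<close>. Expand
  \<open>\<omega>\<close> of two such vectors and, in the terms linear in the \<open>b\<^sub>i\<close>, replace \<open>v\<close> using the
  differentiated \<open>i\<close>-th stage equation: the first hypothesis cancels the terms of order \<open>h\<close>, the
  second cancels the terms of order \<open>h\<^sup>2\<close> in \<open>x\<^sub>i, x\<^sub>j\<close>, and the third those containing \<open>M\<close>.
\<close>

section \<open>The matrix J and its bilinear form\<close>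

lemma symp_J_nth [simp]:
  "symp_J $ Inl a $ Inl b = 0" "symp_J $ Inr a $ Inr b = 0"
  "symp_J $ Inl a $ Inr b = (if a = b then 1 else 0)"
  "symp_J $ Inr a $ Inl b = (if a = b then - 1 else 0)"
  by (simp_all add: symp_J_def)

lemma sum_UNIV_Plus:
  fixes g :: "'a::finite + 'b::finite \<Rightarrow> 'c::comm_monoid_add"
  shows "sum g UNIV = (\<Sum>a\<in>UNIV. g (Inl a)) + (\<Sum>b\<in>UNIV. g (Inr b))"
  by (subst UNIV_Plus_UNIV [symmetric], subst sum.Plus) simp_all

lemma transpose_symp_J: "transpose symp_J = - symp_J"
  unfolding vec_eq_iff
proof (intro allI)
  fix i j :: "'a + 'a"
  show "transpose symp_J $ i $ j = (- symp_J) $ i $ j"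
    by (cases i; cases j) (auto simp: transpose_def)
qed

lemma symp_J_squared: "symp_J ** symp_J = - mat 1"
  unfolding vec_eq_iff
proof (intro allI)
  fix i j :: "'a + 'a"
  show "(symp_J ** symp_J) $ i $ j = (- mat 1 :: real ^ ('a + 'a) ^ ('a + 'a)) $ i $ j"
    by (cases i; cases j)
      (auto simp: matrix_matrix_mult_def sum_UNIV_Plus mat_def if_distrib cong: if_cong
        intro!: sum.neutral)
qed

lemma matrix_add_rdistrib: "(A + B) ** C = A ** C + B ** (C :: real ^ 'p ^ 'n)"
  by (simp add: matrix_matrix_mult_def vec_eq_iff sum.distrib algebra_simps)

lemma matrix_mult_scaleR:
  fixes A :: "real ^ 'n ^ 'm" and B :: "real ^ 'p ^ 'n"
  shows "(c *\<^sub>R A) ** B = c *\<^sub>R (A ** B)" "A ** (c *\<^sub>R B) = c *\<^sub>R (A ** B)"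
  by (simp_all add: matrix_matrix_mult_def vec_eq_iff sum_distrib_left mult_ac)

lemma linear_matrix_mult_left: "linear (\<lambda>X :: real ^ 'p ^ 'n. (A :: real ^ 'n ^ 'm) ** X)"
  by (rule linearI) (simp_all add: matrix_add_ldistrib matrix_mult_scaleR)

lemma matrix_mult_uminus:
  fixes A :: "real ^ 'n ^ 'm" and B :: "real ^ 'p ^ 'n"
  shows "(- A) ** B = - (A ** B)" "A ** (- B) = - (A ** B)"
  by (simp_all add: matrix_matrix_mult_def vec_eq_iff sum_negf)

lemma matrix_inv_symp_J: "matrix_inv symp_J = - symp_J"
proof -
  let ?J = "symp_J :: real ^ ('a + 'a) ^ ('a + 'a)"
  have J: "?J ** - ?J = mat 1" "- ?J ** ?J = mat 1"
    by (simp_all add: matrix_mult_uminus symp_J_squared)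
  \<comment> \<open>\<open>matrix_inv\<close> is a choice operator; the witness \<open>- ?J\<close>
    shows that the chosen matrix really is an inverse, and multiplying by \<open>- ?J\<close> from
    the left then identifies it.\<close>
  then have "?J ** matrix_inv ?J = mat 1"
    unfolding matrix_inv_def by - (rule someI2 [where a = "- ?J"], auto)
  then have "- ?J ** (?J ** matrix_inv ?J) = - ?J"
    by simp
  then show ?thesis
    unfolding matrix_mul_assoc J(2) by simp
qed

lemma uminus_matrix_vector: "(- A) *v v = - (A *v (v :: real ^ 'n))"
  by (simp add: matrix_vector_mult_def vec_eq_iff sum_negf)

lemma inner_matrix_vector: "(A *v u) \<bullet> v = u \<bullet> (transpose A *v (v :: real ^ 'm))"
  for A :: "real ^ 'n ^ 'm"
  by (metis dot_lmul_matrix transpose_matrix_vector inner_commute)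

definition symp_form :: "real ^ ('d::finite + 'd) \<Rightarrow> real ^ ('d + 'd) \<Rightarrow> real" where
  "symp_form u v = u \<bullet> (symp_J *v v)"

lemma bounded_bilinear_symp_form: "bounded_bilinear symp_form"
  unfolding bilinear_conv_bounded_bilinear [symmetric] bilinear_def symp_form_def
  by (auto intro!: linearI simp: algebra_simps)

lemma symp_form_skew: "symp_form u v = - symp_form v u"
  unfolding symp_form_def
  by (subst (2) inner_commute)
    (simp add: inner_matrix_vector transpose_symp_J uminus_matrix_vector
      del: transpose_matrix_vector)

text \<open>The order conditions are matrix identities with terms of this shape; tested on vectors
  they become the scalar identities used in the expansion of the form.\<close>

lemma inner_matrix_product:
  fixes X :: "real ^ 'k ^ 'm" and Y :: "real ^ 'n ^ 'm" and Z :: "real ^ 'l ^ 'n"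
  shows "u \<bullet> ((transpose X ** Y ** Z) *v v) = (X *v u) \<bullet> (Y *v (Z *v v))"
  by (simp add: inner_matrix_vector matrix_vector_mul_assoc matrix_mul_assoc
      del: transpose_matrix_vector)

text \<open>A matrix is determined by its bilinear form, so symplecticity of a Jacobian can be
  checked on pairs of directional derivatives.\<close>

lemma preserves_symp_J_iff:
  "transpose X ** symp_J ** X = symp_J
    \<longleftrightarrow> (\<forall>u v. symp_form (X *v u) (X *v v) = symp_form u v)"
proof -
  have "transpose X ** symp_J ** X = symp_J
      \<longleftrightarrow> (\<forall>v u. u \<bullet> ((transpose X ** symp_J ** X) *v v) = u \<bullet> (symp_J *v v))"
    unfolding matrix_eq vector_eq_ldot ..
  then show ?thesis
    by (simp only: symp_form_def inner_matrix_product) blast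
qed

section \<open>The matrix exponential and its invariance property\<close>

lemma mat_power_scaleR: "mat_power (t *\<^sub>R A) k = t ^ k *\<^sub>R mat_power A k"
  by (induction k) (simp_all add: matrix_mult_scaleR)

text \<open>Left multiplication by \<open>A\<close> is a bounded linear map with some bound
  \<open>K\<close>, so the powers grow at most like \<open>K ^ k\<close>, and the real exponential
  series of \<open>K\<close> dominates.\<close>

lemma summable_mat_exp:
  fixes A :: "real ^ 'n ^ 'n"
  shows "summable (\<lambda>k. (1 / fact k) *\<^sub>R mat_power A k)"
proof -
  obtain K where K: "\<And>X :: real ^ 'n ^ 'n. norm (A ** X) \<le> norm X * K" "K > 0"
    using bounded_linear.pos_bounded [OF linear_matrix_mult_left [unfolded linear_conv_bounded_linear]]
    by blast
  have "norm (mat_power A k) \<le> norm (mat 1 :: real ^ 'n ^ 'n) * K ^ k" for k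
  proof (induction k)
    case (Suc k)
    have "norm (mat_power A (Suc k)) \<le> norm (mat_power A k) * K"
      using K(1) by simp
    also have "\<dots> \<le> norm (mat 1 :: real ^ 'n ^ 'n) * K ^ k * K"
      using Suc K(2) by (intro mult_right_mono) simp_all
    finally show ?case
      by (simp add: mult_ac)
  qed simp
  then have bound: "norm ((1 / fact k) *\<^sub>R mat_power A k)
      \<le> norm (mat 1 :: real ^ 'n ^ 'n) * (K ^ k /\<^sub>R fact k)" for k
    by (simp add: field_simps)
  have "summable (\<lambda>k. norm (mat 1 :: real ^ 'n ^ 'n) * (K ^ k /\<^sub>R fact k))"
    by (intro summable_mult summable_exp_generic)
  then show ?thesis
    by (rule summable_comparison_test' [of _ 0]) (rule bound)
qed

text \<open>
  Testing against linear functionals turns the matrix series into scalar power series, which can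
  be differentiated termwise.
\<close>

lemma mat_exp_linear_functional:
  assumes "bounded_linear (\<phi> :: real ^ 'n ^ 'n \<Rightarrow> real)"
  shows "(\<lambda>k. (\<phi> (mat_power A k) / fact k) * t ^ k) sums \<phi> (mat_exp (t *\<^sub>R A))"
proof -
  interpret bounded_linear \<phi> by fact
  have "(\<lambda>k. \<phi> ((1 / fact k) *\<^sub>R mat_power (t *\<^sub>R A) k)) sums \<phi> (mat_exp (t *\<^sub>R A))"
    unfolding mat_exp_def by (intro sums summable_sums summable_mat_exp)
  then show ?thesis
    by (simp add: scaleR mat_power_scaleR mult.commute)
qed

lemma mat_exp_functional_has_derivative:
  assumes "bounded_linear (\<phi> :: real ^ 'n ^ 'n \<Rightarrow> real)"
  shows "((\<lambda>t. \<phi> (mat_exp (t *\<^sub>R A))) has_field_derivative \<phi> (A ** mat_exp (t *\<^sub>R A))) (at t)"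
proof -
  have "bounded_linear (\<lambda>X. \<phi> (A ** X))"
    using bounded_linear_compose [OF assms] linear_conv_bounded_linear linear_matrix_mult_left
    by blast
  note s' = mat_exp_linear_functional [OF this]
  note s = mat_exp_linear_functional [OF assms]
  \<comment> \<open>Termwise differentiation shifts the index: \<open>Suc k\<close> cancels against
    the factorial and leaves one extra factor \<open>A\<close>. These are the coefficients belonging
    to the functional that sends \<open>X\<close> to \<open>\<phi> (A ** X)\<close>.\<close>
  have "diffs (\<lambda>k. \<phi> (mat_power A k) / fact k) = (\<lambda>k. \<phi> (A ** mat_power A k) / fact k)"
    by (simp add: diffs_def fun_eq_iff del: of_nat_Suc)
  then show ?thesis
    using termdiffs_strong_converges_everywhere [OF sums_summable [OF s], of A t]
      sums_unique [OF s] sums_unique [OF s']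
    by simp
qed

text \<open>The coordinates with respect to \<open>Basis\<close> are bounded linear functionals, so
  the scalar result applies to each of them.\<close>

lemma mat_exp_has_vector_derivative:
  "((\<lambda>t. mat_exp (t *\<^sub>R A)) has_vector_derivative A ** mat_exp (t *\<^sub>R A)) (at t)"
  unfolding has_vector_derivative_def
  by (subst has_derivative_componentwise_within)
    (auto intro!: mat_exp_functional_has_derivative
      [THEN has_field_derivative_imp_has_derivative, THEN has_derivative_eq_rhs])

lemma mat_exp_0: "mat_exp 0 = mat 1"
proof -
  have "mat_power (0 :: real ^ 'a ^ 'a) k = (if k = 0 then mat 1 else 0)" for k
    using mat_power_scaleR [of 0 0 k] by (cases k) simp_all
  then have "(\<lambda>k. (1 / fact k) *\<^sub>R mat_power (0 :: real ^ 'a ^ 'a) k)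
      = (\<lambda>k. if k = 0 then mat 1 else 0)"
    by auto
  then show ?thesis
    by (simp add: mat_exp_def sums_unique [OF sums_single, symmetric])
qed

lemma symp_form_mat_exp:
  assumes skew: "\<And>u v. symp_form (A *v u) v + symp_form u (A *v v) = 0"
  shows "symp_form (mat_exp A *v u) (mat_exp A *v v) = symp_form u v"
proof -
  let ?G = "\<lambda>t. mat_exp (t *\<^sub>R A)"
  have d: "((\<lambda>t. ?G t *v w) has_vector_derivative A *v (?G t *v w)) (at t)" for t w
  proof -
    have "bounded_linear (\<lambda>X. X *v w)"
      unfolding linear_conv_bounded_linear [symmetric]
      by (auto intro!: linearI simp: algebra_simps scaleR_matrix_vector_assoc)
    from bounded_linear.has_vector_derivative [OF this mat_exp_has_vector_derivative]
    show ?thesis by (simp add: matrix_vector_mul_assoc)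
  qed
  \<comment> \<open>The product rule yields exactly the two terms of \<open>skew\<close>, taken at
    the transported vectors.\<close>
  have "((\<lambda>t. symp_form (?G t *v u) (?G t *v v)) has_vector_derivative 0) (at t within UNIV)" for t
    using bounded_bilinear.has_vector_derivative [OF bounded_bilinear_symp_form d [of u t] d [of v t]]
      skew [of "?G t *v u" "?G t *v v"]
    by (simp add: add.commute)
  then obtain c where "\<And>t. symp_form (?G t *v u) (?G t *v v) = c"
    using has_vector_derivative_zero_constant [of UNIV] by auto
  from this [of 1] this [of 0] show ?thesis
    by (simp add: mat_exp_0)
qed

section \<open>Algebra of a single step\<close>

text \<open>The linearized step without calculus: \<open>p\<close> and \<open>q\<close> stand for
  the stage derivatives in the directions \<open>v\<close> and \<open>w\<close>, and
  \<open>x\<close>, \<open>y\<close> for their images under the Jacobians of the vector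
  field.\<close>

lemma bilinear_step_preserved:
  fixes \<omega> :: "'a::real_vector \<Rightarrow> 'a \<Rightarrow> real" and E M :: "'a \<Rightarrow> 'a"
  assumes \<omega>: "bilinear \<omega>" and E: "linear E"
    and v: "\<And>i. i \<in> I \<Longrightarrow> p i = v + h *\<^sub>R (\<Sum>j\<in>I. a i j *\<^sub>R (x j - M (p j)))"
    and w: "\<And>i. i \<in> I \<Longrightarrow> q i = w + h *\<^sub>R (\<Sum>j\<in>I. a i j *\<^sub>R (y j - M (q j)))"
    and c1: "\<And>i. i \<in> I \<Longrightarrow> \<omega> (x i) (E (q i)) + \<omega> (E (p i)) (y i) = 0"
    and c2: "\<And>i j. i \<in> I \<Longrightarrow> j \<in> I \<Longrightarrow> b i * b j * \<omega> (x i) (y j)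
      = b i * a i j * \<omega> (x i) (E (y j)) + b j * a j i * \<omega> (E (x i)) (y j)"
    and c3: "\<And>i j. i \<in> I \<Longrightarrow> j \<in> I \<Longrightarrow>
      b j * a j i * \<omega> (E (M (p i))) (y j) + b i * a i j * \<omega> (x i) (E (M (q j))) = 0"
  shows "\<omega> (E v + h *\<^sub>R (\<Sum>i\<in>I. b i *\<^sub>R x i)) (E w + h *\<^sub>R (\<Sum>i\<in>I. b i *\<^sub>R y i)) = \<omega> (E v) (E w)"
proof -
  have l: "linear (\<lambda>u. \<omega> u z)" "linear (\<omega> z)" for z
    using \<omega> by (auto simp: bilinear_def)
  note lin = l [THEN linear_add] l [THEN linear_diff] l [THEN linear_scale] l [THEN linear_sum]
    linear_add [OF E] linear_diff [OF E] linear_scale [OF E] linear_sum [OF E]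
  have Ev: "\<omega> (E v) (y i) = \<omega> (E (p i)) (y i)
      - h * (\<Sum>j\<in>I. a i j * (\<omega> (E (x j)) (y i) - \<omega> (E (M (p j))) (y i)))" if "i \<in> I" for i
  proof -
    have "v = p i - h *\<^sub>R (\<Sum>j\<in>I. a i j *\<^sub>R (x j - M (p j)))"
      using v [OF that] by simp
    then show ?thesis
      by (simp only: lin real_scaleR_def)
  qed
  have Ew: "\<omega> (x i) (E w) = \<omega> (x i) (E (q i))
      - h * (\<Sum>j\<in>I. a i j * (\<omega> (x i) (E (y j)) - \<omega> (x i) (E (M (q j)))))" if "i \<in> I" for i
  proof -
    have "w = q i - h *\<^sub>R (\<Sum>j\<in>I. a i j *\<^sub>R (y j - M (q j)))"
      using w [OF that] by simp
    then show ?thesis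
      by (simp only: lin real_scaleR_def)
  qed
  \<comment> \<open>\<open>?P\<close> collects what remains after eliminating \<open>v\<close>,
    \<open>?R\<close> what remains after eliminating \<open>w\<close>.\<close>
  let ?P = "\<lambda>i j. b i * a i j * (\<omega> (E (x j)) (y i) - \<omega> (E (M (p j))) (y i))"
  let ?R = "\<lambda>i j. b i * a i j * (\<omega> (x i) (E (y j)) - \<omega> (x i) (E (M (q j))))"
  have "(\<Sum>i\<in>I. b i * \<omega> (E v) (y i)) + (\<Sum>i\<in>I. b i * \<omega> (x i) (E w))
      = (\<Sum>i\<in>I. - h * ((\<Sum>j\<in>I. ?P i j) + (\<Sum>j\<in>I. ?R i j)))"
    unfolding sum.distrib [symmetric]
  proof (rule sum.cong [OF refl])
    fix i assume i: "i \<in> I"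
    have "b i * \<omega> (E v) (y i) + b i * \<omega> (x i) (E w)
        = b i * (\<omega> (x i) (E (q i)) + \<omega> (E (p i)) (y i))
          - h * ((\<Sum>j\<in>I. ?P i j) + (\<Sum>j\<in>I. ?R i j))"
      unfolding Ev [OF i] Ew [OF i] by (simp add: algebra_simps sum_distrib_left)
    then show "b i * \<omega> (E v) (y i) + b i * \<omega> (x i) (E w) = - h * (\<Sum>j\<in>I. ?P i j + ?R i j)"
      using c1 [OF i] by (simp add: sum.distrib)
  qed
  also have "\<dots> = - h * ((\<Sum>i\<in>I. \<Sum>j\<in>I. ?P i j) + (\<Sum>i\<in>I. \<Sum>j\<in>I. ?R i j))"
    unfolding sum.distrib [symmetric] by (rule sum_distrib_left [symmetric])
  \<comment> \<open>Exchanging the indices in \<open>?P\<close> makes its terms carry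
    \<open>b j * a j i\<close> with \<open>x i\<close> and \<open>y j\<close>, so that
    \<open>c2\<close> and \<open>c3\<close> combine them with \<open>?R i j\<close>.\<close>
  also have "(\<Sum>i\<in>I. \<Sum>j\<in>I. ?P i j) = (\<Sum>i\<in>I. \<Sum>j\<in>I. ?P j i)"
    by (rule sum.swap)
  also have "\<dots> + (\<Sum>i\<in>I. \<Sum>j\<in>I. ?R i j) = (\<Sum>i\<in>I. \<Sum>j\<in>I. b i * b j * \<omega> (x i) (y j))"
    unfolding sum.distrib [symmetric]
  proof (intro sum.cong refl)
    fix i j assume "i \<in> I" "j \<in> I"
    with c2 [of i j] c3 [of i j] show "?P j i + ?R i j = b i * b j * \<omega> (x i) (y j)"
      by (simp add: algebra_simps)
  qed
  finally have "(\<Sum>i\<in>I. b i * \<omega> (E v) (y i)) + (\<Sum>i\<in>I. b i * \<omega> (x i) (E w))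
      + h * (\<Sum>i\<in>I. \<Sum>j\<in>I. b i * b j * \<omega> (x i) (y j)) = 0"
    by simp
  \<comment> \<open>The bilinear expansion below produces the quadratic term with the summation
    order reversed.\<close>
  moreover have "(\<Sum>j\<in>I. \<Sum>i\<in>I. b i * b j * \<omega> (x i) (y j))
      = (\<Sum>i\<in>I. \<Sum>j\<in>I. b i * b j * \<omega> (x i) (y j))"
    by (rule sum.swap)
  moreover have "\<omega> (E v + h *\<^sub>R (\<Sum>i\<in>I. b i *\<^sub>R x i)) (E w + h *\<^sub>R (\<Sum>i\<in>I. b i *\<^sub>R y i))
      = \<omega> (E v) (E w) + h * ((\<Sum>i\<in>I. b i * \<omega> (E v) (y i)) + (\<Sum>i\<in>I. b i * \<omega> (x i) (E w))
        + h * (\<Sum>j\<in>I. \<Sum>i\<in>I. b i * b j * \<omega> (x i) (y j)))"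
    by (simp only: lin real_scaleR_def distrib_left sum_distrib_left sum.distrib mult_ac add_ac)
  ultimately show ?thesis
    by simp
qed

section \<open>Differentiability of the gradient field\<close>

text \<open>The components of the gradient are the partial derivatives, and these are differentiable
  by the second level of \<open>C_diff\<close>.\<close>

lemma smooth_fun_gradient_differentiable:
  fixes U :: "'a::euclidean_space \<Rightarrow> real"
  assumes "smooth_fun U"
  shows "gradient U differentiable (at x)"
proof -
  have "C_diff (Suc (Suc 0)) U"
    using assms by (simp only: smooth_fun_def)
  then have U: "U differentiable (at y)"
    and U': "e \<in> Basis \<Longrightarrow> (\<lambda>y. frechet_derivative U (at y) e) differentiable (at y)" for y e
    by auto
  have "frechet_derivative U (at y) e = gradient U y \<bullet> e" for y e
    using frechet_derivative_at [of U "\<lambda>h. h \<bullet> gradient U y" y] gradient_works [OF U]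
    by (metis gderiv_def inner_commute)
  with U' show ?thesis
    by (subst differentiable_componentwise_within) simp
qed

section \<open>Symplecticity of the method\<close>

theorem theorem2p5:
  fixes J Q M E :: "real ^ ('d::finite + 'd) ^ ('d + 'd)"
    and U :: "real ^ ('d + 'd) \<Rightarrow> real"
    and f :: "real ^ ('d + 'd) \<Rightarrow> real ^ ('d + 'd)"
    and h :: real
    and s :: nat
    and a :: "nat \<Rightarrow> nat \<Rightarrow> real"
    and b :: "nat \<Rightarrow> real"
    and Y :: "nat \<Rightarrow> real ^ ('d + 'd) \<Rightarrow> real ^ ('d + 'd)"
    and D :: "nat \<Rightarrow> real ^ ('d + 'd) \<Rightarrow> real ^ ('d + 'd) ^ ('d + 'd)"
    and S :: "(real ^ ('d + 'd)) set"
  assumes J: "J = symp_J"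
    and Q: "transpose Q = Q"
    and U: "smooth_fun U"
    and M: "M = - (matrix_inv J ** Q)"
    and f: "f = (\<lambda>y. matrix_inv J *v gradient U y)"
    and h: "h > 0"
    and E: "E = mat_exp (- (h *\<^sub>R M))"
    and stages: "\<And>x. x \<in> S \<Longrightarrow> mverk_stages_at h M f s a Y x"
    and D: "D = (\<lambda>i x. jacobian f (at (Y i x)))"
    and cond1: "\<And>x i. x \<in> S \<Longrightarrow> i \<in> {1..s} \<Longrightarrow>
      transpose (D i x) ** J ** E + transpose E ** J ** D i x = 0"
    and cond2: "\<And>i j. i \<in> {1..s} \<Longrightarrow> j \<in> {1..s} \<Longrightarrow>
      (b i * b j) *\<^sub>R mat 1
        = (b i * a i j) *\<^sub>R (J ** E ** matrix_inv J) + (b j * a j i) *\<^sub>R transpose E"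
    and cond3: "\<And>x i j. x \<in> S \<Longrightarrow> i \<in> {1..s} \<Longrightarrow> j \<in> {1..s} \<Longrightarrow>
      (b j * a j i) *\<^sub>R (transpose M ** transpose E ** J ** D j x)
        + (b i * a i j) *\<^sub>R (transpose (D i x) ** J ** E ** M) = 0"
  shows "symplectic_method_on S (mverk_step h M f s b Y)"
proof -
  let ?\<Phi> = "mverk_step h M f s b Y"
  have Jinv: "matrix_inv J = - symp_J"
    by (simp add: J matrix_inv_symp_J)
  have E_symp: "symp_form (E *v u) (E *v v) = symp_form u v" for u v
    unfolding E
  proof (rule symp_form_mat_exp)
    have A: "- (h *\<^sub>R M) = - (h *\<^sub>R (symp_J ** Q))"
      by (simp add: M Jinv matrix_mult_uminus)
    \<comment> \<open>Since \<open>M\<close> equals \<open>symp_J ** Q\<close> and J squares to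
      minus the identity, the form turns \<open>- (h *\<^sub>R M)\<close> into \<open>h\<close>
      times the symmetric matrix \<open>Q\<close>.\<close>
    have half: "symp_form u (- (h *\<^sub>R M) *v v) = h * (u \<bullet> (Q *v v))" for u v
      unfolding A symp_form_def
      by (simp add: uminus_matrix_vector scaleR_matrix_vector_assoc [symmetric]
          linear_neg [OF matrix_vector_mul_linear] matrix_vector_mult_scaleR matrix_vector_mul_assoc
          matrix_mul_assoc symp_J_squared matrix_mult_uminus)
    fix u v
    have "v \<bullet> (Q *v u) = u \<bullet> (Q *v v)"
      by (metis Q inner_commute inner_matrix_vector)
    then show "symp_form (- (h *\<^sub>R M) *v u) v + symp_form u (- (h *\<^sub>R M) *v v) = 0"
      using half [of v u] half [of u v] symp_form_skew [of "- (h *\<^sub>R M) *v u" v] by simp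
  qed
  have f_diff: "(f has_derivative (\<lambda>v. jacobian f (at y) *v v)) (at y)" for y
    unfolding jacobian_works [symmetric] f
    by (rule differentiable_compose [OF bounded_linear_imp_differentiable
          [OF matrix_vector_mul_bounded_linear] smooth_fun_gradient_differentiable [OF U]])
  \<comment> \<open>It suffices to treat one step at a point of \<open>S\<close>; the chain rule
    extends this along an orbit.\<close>
  have step: "?\<Phi> differentiable (at x) \<and>
      transpose (jacobian ?\<Phi> (at x)) ** symp_J ** jacobian ?\<Phi> (at x) = symp_J"
    if x: "x \<in> S" for x
  proof -
    define P where "P i = jacobian (Y i) (at x)" for i
    note st = stages [OF x, unfolded mverk_stages_at_def]
    have dY: "(Y i has_derivative (\<lambda>v. P i *v v)) (at x)" if "i \<in> {1..s}" for i
      using st that unfolding P_def jacobian_works [symmetric] by blast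
    have dF: "((\<lambda>y. f (Y i y)) has_derivative (\<lambda>v. D i x *v (P i *v v))) (at x)"
      if "i \<in> {1..s}" for i
      unfolding D using has_derivative_compose [OF dY [OF that] f_diff] by simp
    have P: "P i *v v = v + h *\<^sub>R (\<Sum>j=1..s. a i j *\<^sub>R (D j x *v (P j *v v) - M *v (P j *v v)))"
      if i: "i \<in> {1..s}" for i v
    proof -
      let ?g = "\<lambda>y. y + h *\<^sub>R (\<Sum>j=1..s. a i j *\<^sub>R (- (M *v Y j y) + f (Y j y)))"
      \<comment> \<open>The stage equation holds on a whole neighbourhood of \<open>x\<close>, so
        its two sides have the same derivative there.\<close>
      have ev: "\<forall>\<^sub>F y in nhds x. ?g y = Y i y"
        by (rule eventually_mono [OF conjunct1 [OF st]]) (drule bspec [OF _ i], erule sym)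
      have "(?g has_derivative (\<lambda>v. v + h *\<^sub>R
          (\<Sum>j=1..s. a i j *\<^sub>R (- (M *v (P j *v v)) + D j x *v (P j *v v))))) (at x)"
        by (intro has_derivative_add has_derivative_ident has_derivative_scaleR_right
            has_derivative_sum has_derivative_minus dF
            bounded_linear.has_derivative [OF matrix_vector_mul_bounded_linear] dY)
      then have "(Y i has_derivative (\<lambda>v. v + h *\<^sub>R
          (\<Sum>j=1..s. a i j *\<^sub>R (- (M *v (P j *v v)) + D j x *v (P j *v v))))) (at x)"
        by (rule has_derivative_transform_eventually)
          (use ev in \<open>simp_all add: eventually_nhds_conv_at\<close>)
      from fun_cong [OF has_derivative_unique [OF dY [OF i] this], of v] show ?thesis
        by simp
    qed
    have d\<Phi>: "(?\<Phi> has_derivative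
        (\<lambda>v. E *v v + h *\<^sub>R (\<Sum>i=1..s. b i *\<^sub>R (D i x *v (P i *v v))))) (at x)"
      unfolding mverk_step_def E [symmetric]
      by (intro has_derivative_add has_derivative_ident has_derivative_scaleR_right
          has_derivative_sum dF bounded_linear.has_derivative [OF matrix_vector_mul_bounded_linear])
    then have diff: "?\<Phi> differentiable (at x)"
      by (rule differentiableI)
    have jac: "jacobian ?\<Phi> (at x) *v v
        = E *v v + h *\<^sub>R (\<Sum>i=1..s. b i *\<^sub>R (D i x *v (P i *v v)))" for v
      using has_derivative_unique [OF diff [unfolded jacobian_works] d\<Phi>] by metis
    have JE: "symp_form z (E *v z') = z \<bullet> ((symp_J ** E) *v z')" for z z'
      by (simp add: symp_form_def matrix_vector_mul_assoc)
    have EJ: "symp_form (E *v z) z' = z \<bullet> ((transpose E ** symp_J) *v z')" for z z'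
      by (simp add: symp_form_def inner_matrix_vector matrix_vector_mul_assoc
          del: transpose_matrix_vector)
    have "symp_form (jacobian ?\<Phi> (at x) *v v) (jacobian ?\<Phi> (at x) *v w) = symp_form v w" for v w
      unfolding jac E_symp [symmetric, of v w]
    proof (rule bilinear_step_preserved [OF _ _ P P])
      show "bilinear symp_form"
        using bounded_bilinear_symp_form by (simp add: bilinear_conv_bounded_bilinear)
      show "linear ((*v) E)"
        by simp
    next
      fix i assume i: "i \<in> {1..s}"
      have "(P i *v v) \<bullet> ((transpose (D i x) ** symp_J ** E + transpose E ** symp_J ** D i x)
          *v (P i *v w)) = 0"
        using cond1 [OF x i] by (simp add: J)
      then show "symp_form (D i x *v (P i *v v)) (E *v (P i *v w))
          + symp_form (E *v (P i *v v)) (D i x *v (P i *v w)) = 0"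
        unfolding symp_form_def matrix_vector_mult_add_rdistrib inner_add_right
          inner_matrix_product .
    next
      fix i j assume ij: "i \<in> {1..s}" "j \<in> {1..s}"
      let ?x = "D i x *v (P i *v v)" and ?y = "D j x *v (P j *v w)"
      \<comment> \<open>Multiplying the second condition by J from the right cancels the inverse and
        turns its terms into \<open>symp_J ** E\<close> and \<open>transpose E ** symp_J\<close>,
        the matrices in \<open>JE\<close> and \<open>EJ\<close>.\<close>
      have "(b i * b j) *\<^sub>R symp_J
          = ((b i * a i j) *\<^sub>R (J ** E ** matrix_inv J) + (b j * a j i) *\<^sub>R transpose E) ** symp_J"
        unfolding cond2 [OF ij, symmetric] by (simp add: matrix_mult_scaleR)
      also have "\<dots> = (b i * a i j) *\<^sub>R (symp_J ** E) + (b j * a j i) *\<^sub>R (transpose E ** symp_J)"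
        unfolding matrix_add_rdistrib
        by (simp add: J matrix_inv_symp_J matrix_mult_scaleR
            matrix_mul_assoc [symmetric] matrix_mult_uminus symp_J_squared)
      finally have "?x \<bullet> (((b i * b j) *\<^sub>R symp_J) *v ?y)
          = ?x \<bullet> (((b i * a i j) *\<^sub>R (symp_J ** E) + (b j * a j i) *\<^sub>R (transpose E ** symp_J)) *v ?y)"
        by (rule arg_cong)
      then show "b i * b j * symp_form ?x ?y
          = b i * a i j * symp_form ?x (E *v ?y) + b j * a j i * symp_form (E *v ?x) ?y"
        unfolding JE EJ
        unfolding symp_form_def matrix_vector_mult_add_rdistrib inner_add_right
          scaleR_matrix_vector_assoc [symmetric] inner_scaleR_right .
      \<comment> \<open>Grouping \<open>E ** M\<close> into one factor brings the third condition
        into the shape of \<open>inner_matrix_product\<close>.\<close>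
      have "(P i *v v) \<bullet> (((b j * a j i) *\<^sub>R (transpose (E ** M) ** symp_J ** D j x)
          + (b i * a i j) *\<^sub>R (transpose (D i x) ** symp_J ** (E ** M))) *v (P j *v w)) = 0"
        using cond3 [OF x ij] by (simp add: J matrix_transpose_mul matrix_mul_assoc)
      then show "b j * a j i * symp_form (E *v (M *v (P i *v v))) ?y
          + b i * a i j * symp_form ?x (E *v (M *v (P j *v w))) = 0"
        unfolding symp_form_def matrix_vector_mult_add_rdistrib inner_add_right
          scaleR_matrix_vector_assoc [symmetric] inner_scaleR_right inner_matrix_product
        by (simp only: matrix_vector_mul_assoc [symmetric])
    qed
    with diff show ?thesis
      by (simp add: preserves_symp_J_iff)
  qed
  \<comment> \<open>Only the points before the \<open>n\<close>-th are required to lie in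
    \<open>S\<close>, so an orbit in \<open>S\<close> up to index \<open>n\<close> also covers the
    iterate \<open>Suc n\<close>.\<close>
  have iter: "(?\<Phi> ^^ n) differentiable (at y)" if "\<And>k. k < n \<Longrightarrow> (?\<Phi> ^^ k) y \<in> S" for n y
    using that
  proof (induction n)
    case 0
    show ?case by (simp add: id_def)
  next
    case (Suc n)
    then have "(?\<Phi> ^^ n) differentiable (at y)" "(?\<Phi> ^^ n) y \<in> S"
      by simp_all
    then show ?case
      unfolding funpow.simps by (intro differentiable_chain_at step [THEN conjunct1])
  qed
  show ?thesis
    unfolding symplectic_method_on_def
  proof (intro allI impI)
    fix n y
    assume orbit: "\<forall>k\<le>n. (?\<Phi> ^^ k) y \<in> S"
    let ?x = "(?\<Phi> ^^ n) y"
    let ?A = "jacobian ?\<Phi> (at ?x)" and ?B = "jacobian (?\<Phi> ^^ n) (at y)"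
    have n: "(?\<Phi> ^^ n) differentiable (at y)" and Suc_n: "(?\<Phi> ^^ Suc n) differentiable (at y)"
      using orbit by (auto intro!: iter simp del: funpow.simps)
    have A: "?\<Phi> differentiable (at ?x)" "transpose ?A ** symp_J ** ?A = symp_J"
      using step orbit by auto
    have "(?\<Phi> ^^ Suc n has_derivative (\<lambda>v. ?A *v (?B *v v))) (at y)"
      using diff_chain_at [OF n [unfolded jacobian_works] A(1) [unfolded jacobian_works]]
      by (simp add: o_def)
    then have "(\<lambda>v. jacobian (?\<Phi> ^^ Suc n) (at y) *v v) = (\<lambda>v. ?A *v (?B *v v))"
      by (rule has_derivative_unique [OF Suc_n [unfolded jacobian_works]])
    then have "jacobian (?\<Phi> ^^ Suc n) (at y) = ?A ** ?B"
      unfolding matrix_eq matrix_vector_mul_assoc by metis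
    \<comment> \<open>By the chain rule the factor of the last step is innermost in the product,
      where its symplecticity removes it.\<close>
    then have "transpose (jacobian (?\<Phi> ^^ Suc n) (at y)) ** symp_J ** jacobian (?\<Phi> ^^ Suc n) (at y)
        = transpose ?B ** (transpose ?A ** symp_J ** ?A) ** ?B"
      by (simp add: matrix_transpose_mul matrix_mul_assoc del: funpow.simps)
    with n Suc_n A(2) show "(?\<Phi> ^^ n) differentiable (at y) \<and>
        (?\<Phi> ^^ Suc n) differentiable (at y) \<and>
        transpose (jacobian (?\<Phi> ^^ Suc n) (at y)) ** symp_J ** jacobian (?\<Phi> ^^ Suc n) (at y)
          = transpose ?B ** symp_J ** ?B"
      by (simp del: funpow.simps)
  qed
qed

end
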